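(* For all integers $n\geqslant 1$ and $s\geqslant 0$, the $s$-jet graph $\mathcal{J}_s(K_{n,n})$ of the complete bipartite graph $K_{n,n}$ is very well covered.
   Context: For a simple graph $G$ with vertex set $\{x_1,\dots,x_m\}$ and $s\in\mathbb{N}$, the $s$-jet graph $\mathcal{J}_s(G)$ is the simple graph with vertex set $\{x_{i,j}\mid i=1,\dots,m,\ j=0,\dots,s\}$ in which $\{x_{i,j},x_{k,l}\}$ is an edge if and only if $\{x_i,x_k\}$ is an edge of $G$ and $j+l\leqslant s$. A graph is very well covered if every minimal vertex cover (a vertex set meeting every edge, minimal under inclusion) contains exactly half of the vertices of the graph. *)

theory Defs
  imports "Graph_Theory.Graph_Theory"
begin

text \<open>
  A simple graph is a \<^locale>\<open>pair_graph\<close>: a finite, loop-free digraph with symmetric arc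
  relation, the edge \<open>{u, v}\<close> being represented by the two arcs \<open>(u, v)\<close> and \<open>(v, u)\<close>.
  The vertex \<open>(x, j)\<close> of the jet graph stands for $x_j$; the bound \<open>j + l \<le> s\<close> already
  forces \<open>j\<close> and \<open>l\<close> to be at most \<open>s\<close>.
\<close>

definition jet_graph :: "nat \<Rightarrow> 'a pair_pre_digraph \<Rightarrow> ('a \<times> nat) pair_pre_digraph" where
  "jet_graph s G =
    \<lparr> pverts = pverts G \<times> {0..s},
      parcs = {((x, j), (y, l)) | x j y l. (x, y) \<in> parcs G \<and> j + l \<le> s} \<rparr>"

definition vertex_cover :: "'a pair_pre_digraph \<Rightarrow> 'a set \<Rightarrow> bool" where
  "vertex_cover G C \<longleftrightarrow> C \<subseteq> pverts G \<and> (\<forall>(u, v) \<in> parcs G. u \<in> C \<or> v \<in> C)"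

definition minimal_vertex_cover :: "'a pair_pre_digraph \<Rightarrow> 'a set \<Rightarrow> bool" where
  "minimal_vertex_cover G C \<longleftrightarrow> vertex_cover G C \<and> (\<forall>D. D \<subset> C \<longrightarrow> \<not> vertex_cover G D)"

definition very_well_covered :: "'a pair_pre_digraph \<Rightarrow> bool" where
  "very_well_covered G \<longleftrightarrow>
    (\<forall>C. minimal_vertex_cover G C \<longrightarrow> 2 * card C = card (pverts G))"

lemma pair_graph_jet_graph:
  assumes "pair_graph G"
  shows "pair_graph (jet_graph s G)"
proof -
  interpret G: pair_graph G by fact
  have sub: "parcs (jet_graph s G) \<subseteq> pverts (jet_graph s G) \<times> pverts (jet_graph s G)"
    by (auto simp: jet_graph_def dest: G.in_arcsD1 G.in_arcsD2)
  have fin: "finite (pverts (jet_graph s G))"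
    by (simp add: jet_graph_def G.pair_finite_verts)
  have sym: "sym (parcs G)"
    using G.pair_sym_arcs by (simp add: symmetric_def)
  show ?thesis
  proof unfold_locales
    show "finite (parcs (jet_graph s G))"
      using sub fin by (meson finite_SigmaI finite_subset)
    show "symmetric (with_proj (jet_graph s G))"
      using sym by (auto simp: symmetric_def jet_graph_def sym_def add.commute)
    show "fst e \<noteq> snd e" if "e \<in> parcs (jet_graph s G)" for e
      using that by (auto simp: jet_graph_def dest: G.pair_no_loops)
  qed (use sub fin in auto)
qed

lemma complete_bipartite_exists: "\<exists>G :: nat pair_pre_digraph. K\<^bsub>m,n\<^esub> (with_proj G)"
proof -
  let ?U = "{0..<m}" and ?V = "{m..<m + n}"
  let ?G = "\<lparr> pverts = ?U \<union> ?V, parcs = ?U \<times> ?V \<union> ?V \<times> ?U \<rparr>"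
  have "?U \<inter> ?V = {}" "card ?U = m" "card ?V = n" by auto
  then have "K\<^bsub>m,n\<^esub> (with_proj ?G)"
    unfolding complete_bipartite_digraph_pair_def
    by (intro conjI exI[of _ ?U] exI[of _ ?V]) simp_all
  then show ?thesis by blast
qed

end

theory Submission
  imports Defs
begin

text \<open>
  A vertex of a minimal cover \<open>C\<close> has a neighbour outside \<open>C\<close>. In the jet graph of the complete
  bipartite graph with sides \<open>U\<close> and \<open>V\<close>, adjacency across the sides depends on the second indices
  only, so \<open>C\<close> is determined by the least index \<open>p\<close> at which some vertex over \<open>U\<close> is missing
  (\<open>p = s + 1\<close> if there is none): \<open>C\<close> contains \<open>(v, l)\<close> over \<open>V\<close> exactly when \<open>l + p \<le> s\<close>, and
  then \<open>(u, j)\<close> over \<open>U\<close> exactly when \<open>j < p\<close>. Hence \<open>card C = n * p + n * (s + 1 - p) = n * (s + 1)\<close>.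
\<close>

text \<open>If all neighbours of \<open>v\<close> lay in \<open>C\<close>, then
  \<open>C - {v}\<close> would still be a cover; \<open>(v, v) \<notin> parcs G\<close> excludes a
  loop, which only \<open>v\<close> could cover.\<close>

lemma minimal_vertex_cover_has_outside_neighbour:
  assumes C: "minimal_vertex_cover G C" and "v \<in> C" and "(v, v) \<notin> parcs G"
  obtains u where "u \<notin> C" "(u, v) \<in> parcs G \<or> (v, u) \<in> parcs G"
proof -
  from C \<open>v \<in> C\<close> have "\<not> vertex_cover G (C - {v})"
    unfolding minimal_vertex_cover_def by blast
  moreover from C have "vertex_cover G C"
    by (simp add: minimal_vertex_cover_def)
  ultimately obtain a b where
    "(a, b) \<in> parcs G" "a \<notin> C - {v}" "b \<notin> C - {v}" "a \<in> C \<or> b \<in> C"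
    unfolding vertex_cover_def by blast
  with \<open>(v, v) \<notin> parcs G\<close> that show thesis by auto
qed

lemma minimal_vertex_cover_jet_complete_bipartite:
  assumes verts: "pverts G = U \<union> V" and arcs: "parcs G = U \<times> V \<union> V \<times> U" and disj: "U \<inter> V = {}"
    and C: "minimal_vertex_cover (jet_graph s G) C"
  obtains p where "p \<le> s + 1" "C = U \<times> {..<p} \<union> V \<times> {..<s + 1 - p}"
proof -
  \<comment> \<open>The disjunct \<open>s < j\<close> ensures that a least element exists and yields
    the default \<open>s + 1\<close> if \<open>C\<close> contains all of
    \<open>U \<times> {..s}\<close>.\<close>
  define p where "p = (LEAST j. s < j \<or> (\<exists>x\<in>U. (x, j) \<notin> C))"
  have p: "s < p \<or> (\<exists>x\<in>U. (x, p) \<notin> C)"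
    unfolding p_def by (rule LeastI[of _ "Suc s"]) simp
  have p_le: "p \<le> s + 1"
    unfolding p_def by (rule Least_le) simp
  have below_p: "(x, j) \<in> C" if "x \<in> U" "j < p" for x j
    using not_less_Least[OF \<open>j < p\<close>[unfolded p_def]] that by blast
  have cover: "vertex_cover (jet_graph s G) C"
    using C by (simp add: minimal_vertex_cover_def)
  have sub: "C \<subseteq> (U \<union> V) \<times> {..s}"
    using cover by (auto simp: vertex_cover_def jet_graph_def verts)
  have adj: "((x, j), (y, l)) \<in> parcs (jet_graph s G) \<longleftrightarrow>
      (x \<in> U \<and> y \<in> V \<or> x \<in> V \<and> y \<in> U) \<and> j + l \<le> s" for x j y l
    by (auto simp: jet_graph_def arcs)
  have covered: "(x, j) \<in> C \<or> (y, l) \<in> C" if "x \<in> U" "y \<in> V" "j + l \<le> s" for x j y l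
    using cover that adj[of x j y l] by (auto simp: vertex_cover_def)
  have outside: "\<exists>y l. (y, l) \<notin> C \<and> (x \<in> U \<and> y \<in> V \<or> x \<in> V \<and> y \<in> U) \<and> j + l \<le> s"
    if "(x, j) \<in> C" for x j
  proof -
    have "((x, j), (x, j)) \<notin> parcs (jet_graph s G)"
      using disj by (auto simp: adj)
    with C that obtain w where "w \<notin> C"
      "(w, (x, j)) \<in> parcs (jet_graph s G) \<or> ((x, j), w) \<in> parcs (jet_graph s G)"
      by (rule minimal_vertex_cover_has_outside_neighbour)
    then show ?thesis by (cases w) (auto simp: adj add.commute)
  qed
  have in_V: "(y, l) \<in> C \<longleftrightarrow> l + p \<le> s" if "y \<in> V" for y l
  proof
    assume "(y, l) \<in> C"
    with outside disj \<open>y \<in> V\<close> obtain x j where "x \<in> U" "(x, j) \<notin> C" "l + j \<le> s"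
      by blast
    \<comment> \<open>By the choice of \<open>p\<close>, \<open>(x, j) \<notin> C\<close> forces
      \<open>p \<le> j\<close>.\<close>
    with below_p show "l + p \<le> s"
      by (meson add_left_mono le_trans not_less)
  next
    assume "l + p \<le> s"
    \<comment> \<open>Here \<open>p \<le> s\<close>, which rules out the default value of
      \<open>p\<close>, so a vertex over \<open>U\<close> is missing at index
      \<open>p\<close>.\<close>
    with p obtain x where "x \<in> U" "(x, p) \<notin> C" by auto
    with covered[of x y p l] \<open>y \<in> V\<close> \<open>l + p \<le> s\<close> show "(y, l) \<in> C"
      by (simp add: add.commute)
  qed
  have in_U: "(x, j) \<in> C \<longleftrightarrow> j < p" if "x \<in> U" for x j
  proof
    assume "(x, j) \<in> C"
    with outside disj \<open>x \<in> U\<close> obtain y l where "y \<in> V" "(y, l) \<notin> C" "j + l \<le> s"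
      by blast
    \<comment> \<open>By \<open>in_V\<close>, \<open>(y, l) \<notin> C\<close> means
      \<open>s < l + p\<close>, to be compared with \<open>j + l \<le> s\<close>.\<close>
    with in_V show "j < p" by fastforce
  qed (use below_p that in blast)
  have "C = U \<times> {..<p} \<union> V \<times> {..<s + 1 - p}"
    using sub in_U in_V by fastforce
  with p_le show thesis by (rule that)
qed

theorem theorem4:
  fixes G :: "'a pair_pre_digraph" and n s :: nat
  assumes "n \<ge> 1"
    and "K\<^bsub>n,n\<^esub> (with_proj G)"
  shows "very_well_covered (jet_graph s G)"
proof -
  from assms(2) obtain U V where UV: "pverts G = U \<union> V" "parcs G = U \<times> V \<union> V \<times> U" "U \<inter> V = {}"
    and card_UV: "card U = n" "card V = n"
    unfolding complete_bipartite_digraph_pair_def by auto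
  \<comment> \<open>\<open>card\<close> is 0 on infinite sets, so \<open>n \<ge> 1\<close> gives
    finiteness.\<close>
  have fin: "finite U" "finite V"
    using card_UV \<open>n \<ge> 1\<close> by (auto intro: card_ge_0_finite)
  have "2 * card C = card (pverts (jet_graph s G))"
    if C: "minimal_vertex_cover (jet_graph s G) C" for C
  proof -
    obtain p where "p \<le> s + 1" and C_eq: "C = U \<times> {..<p} \<union> V \<times> {..<s + 1 - p}"
      using UV C by (rule minimal_vertex_cover_jet_complete_bipartite)
    have "card C = n * p + n * (s + 1 - p)"
      unfolding C_eq using fin UV(3) card_UV by (subst card_Un_disjoint) auto
    \<comment> \<open>The subtraction \<open>s + 1 - p\<close> does not truncate, since
      \<open>p \<le> s + 1\<close>.\<close>
    also have "\<dots> = n * (s + 1)"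
      using \<open>p \<le> s + 1\<close> by (simp flip: distrib_left)
    finally show ?thesis
      using fin UV card_UV
      by (simp add: jet_graph_def card_cartesian_product card_Un_disjoint)
  qed
  then show ?thesis by (simp add: very_well_covered_def)
qed

end
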